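(* Let $f$ be a relation on a uniform space $(X,\mathcal U)$. (a) If $A$ is a $\mathcal U$ inward subset for $f$ then there exist $d\in\Gamma(\mathcal U)$ and $\epsilon>0$ such that $\overline{V^d_\epsilon(f(A))}\subset A^\circ$. In particular, $A_1=A^\circ$ and $A_2=\overline{V^d_\epsilon(f(A))}$ are $\mathcal U$ inward for $f$ with $A_1$ open, $A_2$ closed and $\overline{f(A)}\subset A_2\subset A_1\subset A$. (b) Let $A$ be an open $\mathcal U$ inward subset for $f$. If $d\in\Gamma(\mathcal U)$ and $\epsilon>0$ satisfy $V^d_\epsilon(f(A))\subset A$, then $V^d_\epsilon(\mathcal C_{\mathcal U}f(A))\subset A$. In particular, $A$ is a $\mathcal U$ inward subset for $\mathcal C_{\mathcal U}f$ and is $(V^d_\epsilon\circ\mathcal C_{\mathcal U}f)$ $^+$invariant. (c) If $A$ is a $\mathcal U$ inward subset for $f$, then there exists a closed $\mathcal U$ inward subset $B$ for $f^{-1}$ such that $A^\circ\cup B^\circ=X$ and $B\cap f(A)=\emptyset=A\cap f^{-1}(B)$. (d) If $A$ is a $\mathcal U$ inward subset for $f$, then there exists a $\mathcal U$ uniformly continuous elementary Lyapunov function $L$ for $f$ such that $L^{-1}(0)\cup A=X$ and $f(A)\subset L^{-1}(1)$. (e) If $L$ is a $\mathcal U$ elementary Lyapunov function for $f$ and $1\ge\epsilon>0$, then $A=\{x:L(x)>1-\epsilon\}$ is an open set such that $$f(A)\subset\mathcal C_{\mathcal U}f(A)\subset\mathcal C_{d_L}f(A)\subset L^{-1}(1),$$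 $$V^{d_L}_\epsilon(f(A))\subset V^{d_L}_\epsilon(\mathcal C_{\mathcal U}f(A))\subset V^{d_L}_\epsilon(\mathcal C_{d_L}f(A))\subset A .$$ In particular, $L$ is a $\mathcal U(d_L)$ elementary Lyapunov function for $\mathcal C_{d_L}f$ and hence is a $\mathcal U$ elementary Lyapunov function for $\mathcal C_{\mathcal U}f$ and for $\overline f$ (the closure of $f$ in $X\times X$). (f) If $L$ is a $\mathcal U$ elementary Lyapunov function for $f$, then $1-L$ is a $\mathcal U$ elementary Lyapunov function for $f^{-1}$.
   Context: A relation on $X$ is a subset of $X\times X$; $f(A)=\{y:(x,y)\in f\text{ for some }x\in A\}$; $f^{-1}=\{(y,x):(x,y)\in f\}$; $g\circ f=\{(x,z):\exists y,\ (x,y)\in f,(y,z)\in g\}$; $A$ is $f$ $^+$invariant if $f(A)\subset A$. $A^\circ$ and $\overline A$ are interior and closure. All pseudo-metrics are bounded; $V^d_\epsilon=\{(x,y):d(x,y)<\epsilon\}$, and $V^d_\epsilon(B)$ is the image of the set $B$ under this relation. $\mathcal U(d)$ is the uniformity generated by $\{V^d_\epsilon:\epsilon>0\}$; the gage $\Gamma(\mathcal U)$ is the set of bounded pseudo-metrics $d$ with $\mathcal U(d)\subset\mathcal U$. $\mathcal C_df$ is the set of $(x,y)$ such that for every $\epsilon>0$ there are $n\ge1$ and $(a_1,b_1),\dots,(a_n,b_n)\in f$ with $\max(d(x,a_1),d(b_1,a_2),\dots,d(b_{n-1},a_n),d(b_n,y))<\epsilon$, and $\mathcal C_{\mathcal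 U}f=\bigcap_{d\in\Gamma(\mathcal U)}\mathcal C_df$. A set $A\subset X$ is $\mathcal U$ inward for $f$ if there is $U\in\mathcal U$ with $U(f(A))\subset A$; equivalently there are $d\in\Gamma(\mathcal U)$, $\epsilon>0$ with $V^d_\epsilon(f(A))\subset A$. A $\mathcal U$ elementary Lyapunov function for $f$ is a $\mathcal U$ uniformly continuous $L:X\to[0,1]$ such that $(x,y)\in f$ and $L(x)>0$ imply $L(y)=1$. For a bounded $u:X\to\mathbb R$, $d_u(x,y)=|u(x)-u(y)|$. *)

theory Defs
  imports "HOL-Analysis.Analysis"
begin

text \<open>
  A uniformity on a type is a filter on pairs, as in the class \<open>uniform_space\<close>; a set \<open>U\<close> is an
  entourage iff \<open>eventually (\<lambda>p. p \<in> U)\<close> holds.  The uniformity is a parameter of the definitions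
  because \<open>\<U>\<close> and \<open>\<U>(d)\<close> are used on the same space.  The image \<open>f(A)\<close> is \<open>f `` A\<close>, and the
  composite \<open>g \<circ> f\<close> (first \<open>f\<close>, then \<open>g\<close>) is \<open>f O g\<close>.
\<close>

definition bounded_pseudometric :: "('a \<Rightarrow> 'a \<Rightarrow> real) \<Rightarrow> bool" where
  "bounded_pseudometric d \<longleftrightarrow>
     (\<forall>x y. 0 \<le> d x y) \<and> (\<forall>x. d x x = 0) \<and> (\<forall>x y. d x y = d y x) \<and>
     (\<forall>x y z. d x z \<le> d x y + d y z) \<and> (\<exists>M. \<forall>x y. d x y \<le> M)"

definition V :: "('a \<Rightarrow> 'a \<Rightarrow> real) \<Rightarrow> real \<Rightarrow> ('a \<times> 'a) set" where
  "V d \<epsilon> = {(x, y). d x y < \<epsilon>}"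

definition uniformity_of :: "('a \<Rightarrow> 'a \<Rightarrow> real) \<Rightarrow> ('a \<times> 'a) filter" where
  "uniformity_of d = (INF \<epsilon>\<in>{0<..}. principal (V d \<epsilon>))"

text \<open>
  Inclusion of uniformities as sets of entourages is the reverse of the order on filters:
  \<open>\<U>(d) \<subseteq> \<U>\<close> is \<open>\<U> \<le> uniformity_of d\<close>.
\<close>

definition gage :: "('a \<times> 'a) filter \<Rightarrow> ('a \<Rightarrow> 'a \<Rightarrow> real) set" where
  "gage \<U> = {d. bounded_pseudometric d \<and> \<U> \<le> uniformity_of d}"

definition chain_d :: "('a \<Rightarrow> 'a \<Rightarrow> real) \<Rightarrow> ('a \<times> 'a) set \<Rightarrow> ('a \<times> 'a) set" where
  "chain_d d f = {(x, y). \<forall>\<epsilon>>0. \<exists>n\<ge>1. \<exists>a b :: nat \<Rightarrow> 'a.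
     (\<forall>i\<in>{1..n}. (a i, b i) \<in> f) \<and>
     d x (a 1) < \<epsilon> \<and> (\<forall>i\<in>{1..<n}. d (b i) (a (Suc i)) < \<epsilon>) \<and> d (b n) y < \<epsilon>}"

definition chain_U :: "('a \<times> 'a) filter \<Rightarrow> ('a \<times> 'a) set \<Rightarrow> ('a \<times> 'a) set" where
  "chain_U \<U> f = (\<Inter>d\<in>gage \<U>. chain_d d f)"

definition inward :: "('a \<times> 'a) filter \<Rightarrow> ('a \<times> 'a) set \<Rightarrow> 'a set \<Rightarrow> bool" where
  "inward \<U> f A \<longleftrightarrow> (\<exists>U. eventually (\<lambda>p. p \<in> U) \<U> \<and> U `` (f `` A) \<subseteq> A)"

definition plus_invariant :: "('a \<times> 'a) set \<Rightarrow> 'a set \<Rightarrow> bool" where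
  "plus_invariant f A \<longleftrightarrow> f `` A \<subseteq> A"

text \<open>
  The first conjunct is uniform continuity with respect to \<open>\<U>\<close>; for the uniformity of the class it
  is \<open>uniformly_continuous_on UNIV L\<close>.
\<close>

definition elementary_lyapunov ::
  "('a \<times> 'a) filter \<Rightarrow> ('a \<times> 'a) set \<Rightarrow> ('a \<Rightarrow> real) \<Rightarrow> bool" where
  "elementary_lyapunov \<U> f L \<longleftrightarrow>
     filterlim (\<lambda>(x, y). (L x, L y)) uniformity \<U> \<and>
     (\<forall>x. L x \<in> {0..1}) \<and>
     (\<forall>x y. (x, y) \<in> f \<and> L x > 0 \<longrightarrow> L y = 1)"

definition d_fun :: "('a \<Rightarrow> real) \<Rightarrow> 'a \<Rightarrow> 'a \<Rightarrow> real" where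
  "d_fun u x y = \<bar>u x - u y\<bar>"

end

theory Submission
  imports Defs
begin

text \<open>
  Everything rests on a Urysohn lemma for uniformities: if \<open>U(B) \<subseteq> A\<close> for an entourage \<open>U\<close>, there
  is a uniformly continuous \<open>L\<close> that is 1 on \<open>B\<close> and 0 off \<open>A\<close>.  One takes entourages
  \<open>E\<^sub>n\<close> with \<open>E\<^sub>0 \<subseteq> U\<close> and \<open>E\<^sub>n\<^sub>+\<^sub>1\<^sup>3 \<subseteq> E\<^sub>n\<close>; then \<open>1 - L(x)\<close> is the least cost of a path from \<open>B\<close> to \<open>x\<close>,
  truncated at 1, where a step in \<open>E\<^sub>n\<close> costs \<open>2\<^sup>-\<^sup>n\<close>.  The pseudo-metrics \<open>d\<^sub>L\<close> of such functions
  are all that is needed from the gage.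
\<close>

section \<open>Urysohn functions for uniformities\<close>

text \<open>The first two steps combine through \<open>D2\<close> into a pair of \<open>D1\<close>,
  the third lies in \<open>D1\<close> already, and two pairs of \<open>D1\<close> compose into
  \<open>U\<close>.\<close>

lemma entourage_cube_root:
  fixes U :: "('a::uniform_space \<times> 'a) set"
  assumes "eventually (\<lambda>p. p \<in> U) uniformity"
  obtains W where "eventually (\<lambda>p. p \<in> W) uniformity" "sym W" "Id \<subseteq> W" "W O W O W \<subseteq> U"
proof -
  obtain D1 where D1: "eventually D1 uniformity"
    and U: "\<And>x y z. D1 (x, y) \<Longrightarrow> D1 (y, z) \<Longrightarrow> (x, z) \<in> U"
    using uniformity_transE[OF assms] by blast
  obtain D2 where D2: "eventually D2 uniformity"
    and D12: "\<And>x y z. D2 (x, y) \<Longrightarrow> D2 (y, z) \<Longrightarrow> D1 (x, z)"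
    using uniformity_transE[OF D1] by blast
  let ?D = "\<lambda>p. D1 p \<and> D2 p"
  have ev: "eventually ?D uniformity"
    using D1 D2 by (rule eventually_conj)
  have ev': "eventually (\<lambda>(x, y). ?D (y, x)) uniformity"
    using uniformity_sym[OF ev] .
  \<comment> \<open>Imposing both conditions in both directions makes \<open>W\<close> symmetric; it
    is still an entourage because the uniformity is closed under converse.\<close>
  define W where "W = {(x, y). ?D (x, y) \<and> ?D (y, x)}"
  show thesis
  proof
    show "eventually (\<lambda>p. p \<in> W) uniformity"
      using ev ev' by eventually_elim (auto simp: W_def)
    show "sym W"
      by (auto simp: W_def sym_def)
    show "Id \<subseteq> W"
      using uniformity_refl[OF ev] by (auto simp: W_def)
    show "W O W O W \<subseteq> U"
      using U D12 by (fastforce simp: W_def)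
  qed
qed

section \<open>Paths of entourage steps and their cost\<close>

primrec path_rel :: "(nat \<Rightarrow> ('a \<times> 'a) set) \<Rightarrow> nat list \<Rightarrow> ('a \<times> 'a) set" where
  "path_rel E [] = Id"
| "path_rel E (n # ns) = E n O path_rel E ns"

definition path_cost :: "nat list \<Rightarrow> real" where
  "path_cost ns = (\<Sum>n\<leftarrow>ns. (1/2) ^ n)"

lemma path_rel_append: "path_rel E (ms @ ns) = path_rel E ms O path_rel E ns"
  by (induction ms) auto

lemma path_cost_simps [simp]:
  "path_cost [] = 0"
  "path_cost (n # ns) = (1/2) ^ n + path_cost ns"
  "path_cost (ms @ ns) = path_cost ms + path_cost ns"
  by (simp_all add: path_cost_def)

lemma path_cost_nonneg: "0 \<le> path_cost ns"
  by (induction ns) auto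

lemma path_cost_split:
  assumes "0 < c" "c \<le> path_cost ns"
  shows "\<exists>ks n ls. ns = ks @ n # ls \<and> path_cost ks < c \<and> c \<le> path_cost ks + (1/2) ^ n"
  using assms(2)
proof (induction ns rule: rev_induct)
  case Nil
  with assms(1) show ?case by simp
next
  case (snoc n ns)
  show ?case
  proof (cases "c \<le> path_cost ns")
    case True
    with snoc.IH show ?thesis by (metis append_Cons append_assoc)
  next
    case False
    with snoc.prems have "path_cost ns < c \<and> c \<le> path_cost ns + (1/2) ^ n"
      by simp
    then show ?thesis by blast
  qed
qed

text \<open>A path that costs less than \<open>2\<^sup>-\<^sup>m\<close> is cut at the step where half of this budget is reached.\<close>

lemma path_rel_subset:
  assumes cube: "\<And>n. E (Suc n) O E (Suc n) O E (Suc n) \<subseteq> E n"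
    and refl: "\<And>n. Id \<subseteq> E n"
    and "path_cost ns < (1/2) ^ m"
  shows "path_rel E ns \<subseteq> E m"
  using assms(3)
proof (induction "length ns" arbitrary: ns m rule: less_induct)
  case less
  have comp: "P O Q O R \<subseteq> E n"
    if "P \<subseteq> E (Suc n)" "Q \<subseteq> E (Suc n)" "R \<subseteq> E (Suc n)" for P Q R n
    using relcomp_mono[OF that(1) relcomp_mono[OF that(2,3)]] cube by (rule order_trans)
  have step: "E (Suc n) \<subseteq> E n" for n
    using comp[OF subset_refl refl refl] by simp
  have dec: "E k \<subseteq> E l" if "l \<le> k" for k l
    using lift_Suc_antimono_le[of E, OF step that] .
  show ?case
  proof (cases "(1/2) ^ Suc m \<le> path_cost ns")
    case True
    then obtain ks n ls where ns: "ns = ks @ n # ls"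
      and ks: "path_cost ks < (1/2) ^ Suc m" and n: "(1/2) ^ Suc m \<le> path_cost ks + (1/2) ^ n"
      using path_cost_split[of "(1/2) ^ Suc m" ns] by auto
    \<comment> \<open>The whole path costs less than \<open>(1/2) ^ m\<close>, and the prefix
      together with the step \<open>n\<close> uses at least half of that, so less than half
      remains.\<close>
    have "path_cost ls < (1/2) ^ Suc m"
      using less.prems n by (simp add: ns)
    then have ls: "path_rel E ls \<subseteq> E (Suc m)"
      using less.hyps[of ls] by (simp add: ns)
    have ks: "path_rel E ks \<subseteq> E (Suc m)"
      using less.hyps[of ks] ks by (simp add: ns)
    \<comment> \<open>The step at the cut is bounded only by the whole budget, but this already
      gives \<open>m < n\<close>, so all three factors lie in \<open>E (Suc m)\<close>.\<close>
    have "(1/2::real) ^ n < (1/2) ^ m"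
      using less.prems path_cost_nonneg[of ks] path_cost_nonneg[of ls]
      unfolding ns path_cost_simps by linarith
    then have "m < n"
      by (simp add: power_strict_decreasing_iff)
    then have "E n \<subseteq> E (Suc m)"
      by (intro dec) simp
    with ks ls show ?thesis
      by (simp add: ns path_rel_append comp)
  next
    case False
    \<comment> \<open>The list \<open>ns\<close> itself is no shorter, so the induction hypothesis
      does not apply to it. Its first step is split off, and \<open>Id\<close> fills the third place
      of the cube.\<close>
    show ?thesis
    proof (cases ns)
      case Nil
      with refl show ?thesis by simp
    next
      case (Cons n ls)
      then have n: "(1/2) ^ n + path_cost ls < (1/2) ^ Suc m"
        using False by simp
      then have "(1/2::real) ^ n < (1/2) ^ Suc m"
        using path_cost_nonneg[of ls] by linarith
      then have "Suc m < n"
        by (subst (asm) power_strict_decreasing_iff) auto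
      then have 1: "E n \<subseteq> E (Suc m)"
        by (intro dec) simp
      have "path_cost ls < (1/2) ^ Suc m"
        using n zero_less_power[of "1/2::real" n] by linarith
      then have "path_rel E ls \<subseteq> E (Suc m)"
        using less.hyps[of ls] Cons by simp
      with 1 show ?thesis
        using comp[OF 1 _ refl, of "path_rel E ls"] by (simp add: Cons)
    qed
  qed
qed

section \<open>Uniform continuity and separating functions\<close>

lemma uniform_continuityI:
  fixes L :: "'a \<Rightarrow> real"
  assumes "\<And>e. 0 < e \<Longrightarrow> eventually (\<lambda>(x, y). \<bar>L x - L y\<bar> < e) F"
  shows "filterlim (\<lambda>(x, y). (L x, L y)) uniformity F"
  unfolding filterlim_iff eventually_uniformity_metric
proof safe
  fix P :: "real \<times> real \<Rightarrow> bool" and e :: real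
  assume "0 < e" and P: "\<forall>x y. dist x y < e \<longrightarrow> P (x, y)"
  from assms[OF \<open>0 < e\<close>] show "eventually (\<lambda>p. P (case p of (x, y) \<Rightarrow> (L x, L y))) F"
    by eventually_elim (use P in \<open>auto simp: dist_real_def\<close>)
qed

lemma uniform_continuityD:
  fixes L :: "'a \<Rightarrow> real"
  assumes "filterlim (\<lambda>(x, y). (L x, L y)) uniformity F" "0 < e"
  shows "eventually (\<lambda>(x, y). \<bar>L x - L y\<bar> < e) F"
proof -
  have "eventually (\<lambda>(x, y). dist x y < e) (uniformity :: (real \<times> real) filter)"
    using assms(2) by (auto simp: eventually_uniformity_metric)
  from filterlim_compose[OF filterlim_ident assms(1), unfolded filterlim_iff, rule_format, OF this]
  show ?thesis
    by (rule eventually_mono) (auto simp: dist_real_def)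
qed

definition separates :: "('a::uniform_space \<Rightarrow> real) \<Rightarrow> 'a set \<Rightarrow> 'a set \<Rightarrow> bool" where
  "separates L B A \<longleftrightarrow> filterlim (\<lambda>(x, y). (L x, L y)) uniformity uniformity \<and>
     (\<forall>x. L x \<in> {0..1}) \<and> (\<forall>x\<in>B. L x = 1) \<and> (\<forall>x. x \<notin> A \<longrightarrow> L x = 0)"

lemma separatesD:
  assumes "separates L B A"
  shows "filterlim (\<lambda>(x, y). (L x, L y)) uniformity uniformity"
    "\<And>x. L x \<in> {0..1}" "\<And>x. x \<in> B \<Longrightarrow> L x = 1" "\<And>x. x \<notin> A \<Longrightarrow> L x = 0"
  using assms unfolding separates_def by auto

text \<open>This is the chain construction from the metrization of uniformities, started from a set.
  A step in \<open>E n\<close> raises the cost by at most \<open>(1/2) ^ n\<close>, which gives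
  uniform continuity; a path of cost below 1 composes to a pair of \<open>E 0\<close>, hence of
  \<open>U\<close>, so from \<open>B\<close> it cannot end outside \<open>A\<close>.\<close>

lemma entourage_urysohn:
  fixes U :: "('a::uniform_space \<times> 'a) set"
  assumes U: "eventually (\<lambda>p. p \<in> U) uniformity" and UB: "U `` B \<subseteq> A"
  obtains L where "separates L B A"
proof -
  let ?ent = "\<lambda>W. eventually (\<lambda>p. p \<in> W) (uniformity :: ('a \<times> 'a) filter)"
  obtain W0 where W0: "?ent W0" "sym W0" "Id \<subseteq> W0" "W0 O W0 O W0 \<subseteq> U"
    using entourage_cube_root[OF U] .
  have "W0 \<subseteq> U"
    using relcomp_mono[OF subset_refl relcomp_mono[OF W0(3,3)], of W0] W0(4) by simp
  let ?P = "\<lambda>W. ?ent W \<and> sym W \<and> Id \<subseteq> W"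
  \<comment> \<open>The clause for \<open>n = 0\<close> carries the start value \<open>W0\<close>
    through the dependent choice; it yields \<open>E 0 \<subseteq> U\<close>.\<close>
  have "\<exists>E. \<forall>n. (?P (E n) \<and> (n = 0 \<longrightarrow> E n = W0)) \<and> E (Suc n) O E (Suc n) O E (Suc n) \<subseteq> E n"
  proof (rule dependent_nat_choice)
    show "\<exists>W. ?P W \<and> (0 = 0 \<longrightarrow> W = W0)"
      using W0(1-3) by (intro exI[of _ W0] conjI impI refl)
  next
    fix W and n :: nat
    assume "?P W \<and> (n = 0 \<longrightarrow> W = W0)"
    then have W: "?ent W" by simp
    obtain W' where W': "?ent W'" "sym W'" "Id \<subseteq> W'" "W' O W' O W' \<subseteq> W"
      using entourage_cube_root[OF W] .
    then show "\<exists>W'. (?P W' \<and> (Suc n = 0 \<longrightarrow> W' = W0)) \<and> W' O W' O W' \<subseteq> W"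
      by (intro exI[of _ W'] conjI) auto
  qed
  then obtain E where E: "\<And>n. ?P (E n) \<and> (n = 0 \<longrightarrow> E n = W0)"
    and cube: "\<And>n. E (Suc n) O E (Suc n) O E (Suc n) \<subseteq> E n"
    by metis
  have ent: "?ent (E n)" and sym: "sym (E n)" and refl: "Id \<subseteq> E n" for n
    using E[of n] by simp_all
  have "E 0 \<subseteq> U"
    using E[of 0] \<open>W0 \<subseteq> U\<close> by simp
  \<comment> \<open>The element 1 truncates the cost and keeps the set nonempty when no path from
    \<open>B\<close> reaches \<open>x\<close>.\<close>
  define S where "S x = insert 1 {path_cost ns |ns. \<exists>b\<in>B. (b, x) \<in> path_rel E ns}" for x
  define p where "p x = Inf (S x)" for x
  have S0: "0 \<le> r" if "r \<in> S x" for r x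
    using that path_cost_nonneg by (auto simp: S_def)
  have bdd: "bdd_below (S x)" for x
    using S0 by (rule bdd_belowI)
  have p_le: "p x \<le> r" if "r \<in> S x" for r x
    unfolding p_def using that bdd by (rule cInf_lower)
  have p_ge: "c \<le> p x" if "\<And>r. r \<in> S x \<Longrightarrow> c \<le> r" for c x
    unfolding p_def using that by (intro cInf_greatest) (auto simp: S_def)
  have step: "p y \<le> p x + (1/2) ^ n" if "(x, y) \<in> E n" for x y n
  proof -
    have "p y - (1/2) ^ n \<le> p x"
    proof (rule p_ge)
      fix r
      assume "r \<in> S x"
      then consider "r = 1" | ns b where "r = path_cost ns" "b \<in> B" "(b, x) \<in> path_rel E ns"
        by (auto simp: S_def)
      then show "p y - (1/2) ^ n \<le> r"
      proof cases
        case 1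
        have "p y \<le> 1" by (rule p_le) (simp add: S_def)
        with 1 show ?thesis by (simp add: add_increasing2 algebra_simps)
      next
        case 2
        then have "(b, y) \<in> path_rel E (ns @ [n])"
          using that by (auto simp: path_rel_append)
        with 2 have "path_cost (ns @ [n]) \<in> S y"
          unfolding S_def by blast
        from p_le[OF this] 2 show ?thesis by simp
      qed
    qed
    then show ?thesis by simp
  qed
  have "separates (\<lambda>x. 1 - p x) B A"
    unfolding separates_def
  proof (intro conjI allI ballI impI)
    show "filterlim (\<lambda>(x, y). (1 - p x, 1 - p y)) uniformity uniformity"
    proof (rule uniform_continuityI)
      fix e :: real
      assume "0 < e"
      then obtain n where n: "(1/2) ^ n < e"
        using real_arch_pow_inv[of e "1/2"] by auto
      show "eventually (\<lambda>(x, y). \<bar>(1 - p x) - (1 - p y)\<bar> < e) uniformity"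
        using ent[of n]
      proof eventually_elim
        case (elim q)
        obtain x y where q: "q = (x, y)" by force
        \<comment> \<open>Symmetry of \<open>E n\<close> turns the one-sided estimate
          \<open>step\<close> into a bound on the absolute difference.\<close>
        have "(y, x) \<in> E n"
          using elim symD[OF sym[of n]] by (simp add: q)
        then show ?case
          using step[of x y n] step[of y x n] elim n by (auto simp: q)
      qed
    qed
    show "1 - p x \<in> {0..1}" for x
      using p_ge[of x 0] S0 p_le[of 1 x] by (simp add: S_def)
    show "1 - p x = 1" if "x \<in> B" for x
    proof -
      have "path_cost [] \<in> S x"
        unfolding S_def using that by (force intro!: exI[of _ "[]"])
      then show ?thesis
        using p_le[of 0 x] p_ge[of x 0] S0 by force
    qed
    show "1 - p x = 0" if "x \<notin> A" for x
    proof -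
      have "1 \<le> p x"
      proof (rule p_ge, rule ccontr)
        fix r
        assume "r \<in> S x" "\<not> 1 \<le> r"
        then obtain ns b where ns: "r = path_cost ns" "b \<in> B" "(b, x) \<in> path_rel E ns"
          by (auto simp: S_def)
        moreover from this \<open>\<not> 1 \<le> r\<close> have "path_cost ns < (1/2) ^ 0"
          by simp
        ultimately have "(b, x) \<in> U"
          using path_rel_subset[of E, OF cube refl] \<open>E 0 \<subseteq> U\<close> by blast
        with \<open>b \<in> B\<close> UB that show False by blast
      qed
      moreover have "p x \<le> 1"
        by (rule p_le) (simp add: S_def)
      ultimately show ?thesis by simp
    qed
  qed
  then show thesis by (rule that)
qed

section \<open>Pseudo-metrics in the gage\<close>

lemma entourage_V:
  assumes "d \<in> gage \<U>" "0 < \<epsilon>"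
  shows "eventually (\<lambda>p. p \<in> V d \<epsilon>) \<U>"
proof -
  have "\<U> \<le> principal (V d \<epsilon>)"
    using assms unfolding gage_def uniformity_of_def
    by (auto intro: order_trans INF_lower)
  then show ?thesis by (simp add: le_principal)
qed

lemma gageI:
  assumes "bounded_pseudometric d" "\<And>e. 0 < e \<Longrightarrow> eventually (\<lambda>p. p \<in> V d e) \<U>"
  shows "d \<in> gage \<U>"
  using assms by (auto simp: gage_def uniformity_of_def le_principal intro!: INF_greatest)

lemma gage_bounded_pseudometric: "d \<in> gage \<U> \<Longrightarrow> bounded_pseudometric d"
  by (simp add: gage_def)

lemma bounded_pseudometric_d_fun:
  assumes "\<And>x. L x \<in> {0..1}"
  shows "bounded_pseudometric (d_fun L)"
  unfolding bounded_pseudometric_def d_fun_def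
proof (intro conjI exI allI)
  show "\<bar>L x - L y\<bar> \<le> 1" for x y
    using assms[of x] assms[of y] by auto
qed auto

text \<open>Every pseudo-metric constructed below is of this form or is a given one plus one of this
  form.\<close>

lemma d_fun_gage:
  assumes "filterlim (\<lambda>(x, y). (L x, L y)) uniformity \<U>" "\<And>x. L x \<in> {0..1}"
  shows "d_fun L \<in> gage \<U>"
proof (rule gageI)
  show "bounded_pseudometric (d_fun L)"
    using assms(2) by (rule bounded_pseudometric_d_fun)
  show "eventually (\<lambda>p. p \<in> V (d_fun L) e) \<U>" if "0 < e" for e
    using uniform_continuityD[OF assms(1) that]
    by eventually_elim (auto simp: V_def d_fun_def)
qed

text \<open>Lets a single chain be short for two pseudo-metrics at once, since the sum dominates
  each of them.\<close>

lemma gage_add: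
  assumes d: "d \<in> gage \<U>" and d': "d' \<in> gage \<U>"
  shows "(\<lambda>x y. d x y + d' x y) \<in> gage \<U>"
proof (rule gageI)
  have bd: "bounded_pseudometric d" and bd': "bounded_pseudometric d'"
    using assms by (simp_all add: gage_bounded_pseudometric)
  have tri: "d x z + d' x z \<le> (d x y + d' x y) + (d y z + d' y z)" for x y z
  proof -
    have "d x z \<le> d x y + d y z" "d' x z \<le> d' x y + d' y z"
      using bd bd' unfolding bounded_pseudometric_def by blast+
    then show ?thesis by linarith
  qed
  obtain M M' where "\<And>x y. d x y \<le> M" "\<And>x y. d' x y \<le> M'"
    using bd bd' unfolding bounded_pseudometric_def by metis
  then have bound: "d x y + d' x y \<le> M + M'" for x y
    by (simp add: add_mono)
  show "bounded_pseudometric (\<lambda>x y. d x y + d' x y)"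
    unfolding bounded_pseudometric_def
  proof (intro conjI exI allI)
    show "0 \<le> d x y + d' x y" "d x x + d' x x = 0" "d x y + d' x y = d y x + d' y x" for x y
      using bd bd' unfolding bounded_pseudometric_def by simp_all
  qed (use tri bound in blast)+
  show "eventually (\<lambda>p. p \<in> V (\<lambda>x y. d x y + d' x y) e) \<U>" if "0 < e" for e
  proof -
    have "0 < e / 2" using that by simp
    from entourage_V[OF d this] entourage_V[OF d' this] show ?thesis
      by eventually_elim (auto simp: V_def)
  qed
qed

section \<open>Open sets and inward sets through separating functions\<close>

lemma uniform_continuity_imp_continuous:
  fixes L :: "'a::uniform_space \<Rightarrow> real"
  assumes "filterlim (\<lambda>(x, y). (L x, L y)) uniformity uniformity"
  shows "continuous_on UNIV L"
  using assms uniformly_continuous_imp_continuous[of UNIV L]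
  by (simp add: uniformly_continuous_on_uniformity)

lemma open_greater:
  fixes L :: "'a::uniform_space \<Rightarrow> real"
  assumes "filterlim (\<lambda>(x, y). (L x, L y)) uniformity uniformity"
  shows "open {x. c < L x}"
  using uniform_continuity_imp_continuous[OF assms] by (intro open_Collect_less) auto

lemma inwardI:
  assumes "d \<in> gage \<U>" "0 < \<epsilon>" "V d \<epsilon> `` (f `` A) \<subseteq> A"
  shows "inward \<U> f A"
  using assms entourage_V unfolding inward_def by blast

lemma inward_urysohn:
  fixes f :: "('a::uniform_space \<times> 'a) set"
  assumes "inward uniformity f A"
  obtains L where "separates L (f `` A) A"
proof -
  obtain U where U: "eventually (\<lambda>p. p \<in> U) uniformity" "U `` (f `` A) \<subseteq> A"
    using assms unfolding inward_def by blast
  then show thesis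
    using entourage_urysohn that by metis
qed

text \<open>A function that is 1 at \<open>x\<close> and 0 off \<open>A\<close> puts every point off
  \<open>A\<close> at \<open>d_fun\<close> distance exactly 1 from \<open>x\<close>, so radius 1
  works.\<close>

lemma open_gage_neighbourhood:
  fixes A :: "'a::uniform_space set"
  assumes "open A" "x \<in> A"
  obtains d where "d \<in> gage uniformity" "V d 1 `` {x} \<subseteq> A"
proof -
  \<comment> \<open>The entourage given by openness restricts only the pairs that start at
    \<open>x\<close>.\<close>
  have "eventually (\<lambda>(x', y). x' = x \<longrightarrow> y \<in> A) uniformity"
    using assms unfolding open_uniformity by blast
  then have ent: "eventually (\<lambda>p. p \<in> {(x', y). x' = x \<longrightarrow> y \<in> A}) uniformity"
    by (simp add: case_prod_unfold)
  have sub: "{(x', y). x' = x \<longrightarrow> y \<in> A} `` {x} \<subseteq> A"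
    by auto
  obtain L where "separates L {x} A"
    using entourage_urysohn[OF ent sub] .
  note L = separatesD[OF this]
  show thesis
  proof
    show "d_fun L \<in> gage uniformity"
      using L(1,2) by (rule d_fun_gage)
    show "V (d_fun L) 1 `` {x} \<subseteq> A"
    proof
      fix y
      assume "y \<in> V (d_fun L) 1 `` {x}"
      then have "L y \<noteq> 0"
        using L(3)[of x] by (auto simp: V_def d_fun_def)
      then show "y \<in> A"
        using L(4) by blast
    qed
  qed
qed

section \<open>Inward sets\<close>

text \<open>Level sets of a function that is 1 on \<open>f(A)\<close> and 0 off \<open>A\<close> fit
  in between: the closed set where it is at least 1/2 lies in the open set where it is
  positive.\<close>

lemma inward_interpolation:
  fixes f :: "('a::uniform_space \<times> 'a) set"
  assumes "inward uniformity f A"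
  shows "\<exists>d\<in>gage uniformity. \<exists>\<epsilon>>0. closure (V d \<epsilon> `` (f `` A)) \<subseteq> interior A"
proof -
  obtain L where "separates L (f `` A) A"
    using inward_urysohn[OF assms] .
  note L = separatesD[OF this]
  have "closed {x. 1/2 \<le> L x}"
    using uniform_continuity_imp_continuous[OF L(1)] by (intro closed_Collect_le) auto
  moreover have "V (d_fun L) (1/2) `` (f `` A) \<subseteq> {x. 1/2 \<le> L x}"
  proof
    fix y
    assume "y \<in> V (d_fun L) (1/2) `` (f `` A)"
    then obtain x where "x \<in> f `` A" "\<bar>L x - L y\<bar> < 1/2"
      by (auto simp: V_def d_fun_def)
    moreover from this have "L x = 1"
      by (intro L(3))
    ultimately have "1/2 \<le> L y"
      by linarith
    then show "y \<in> {x. 1/2 \<le> L x}" ..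
  qed
  ultimately have "closure (V (d_fun L) (1/2) `` (f `` A)) \<subseteq> {x. 1/2 \<le> L x}"
    by (intro closure_minimal)
  also have "\<dots> \<subseteq> {x. 0 < L x}"
    by auto
  also have "\<dots> \<subseteq> interior A"
    using L(4) by (intro interior_maximal open_greater[OF L(1)]) force
  finally show ?thesis
    using d_fun_gage[OF L(1,2)] by (intro bexI[of _ "d_fun L"] exI[of _ "1/2"]) auto
qed

lemma subset_V_Image:
  assumes "d \<in> gage \<U>" "0 < \<epsilon>"
  shows "B \<subseteq> V d \<epsilon> `` B"
proof
  fix x
  assume "x \<in> B"
  moreover have "(x, x) \<in> V d \<epsilon>"
    using assms by (simp add: V_def gage_def bounded_pseudometric_def)
  ultimately show "x \<in> V d \<epsilon> `` B" by blast
qed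

text \<open>Both sets lie between \<open>V d \<epsilon>\<close> (f \<open>A)\<close> and
  \<open>A\<close>. Any such set is inward, because the image of a smaller set is smaller.\<close>

lemma inward_interior_closure:
  fixes f :: "('a::uniform_space \<times> 'a) set"
  assumes d: "d \<in> gage uniformity" "0 < \<epsilon>"
    and sub: "closure (V d \<epsilon> `` (f `` A)) \<subseteq> interior A"
  shows "inward uniformity f (interior A)"
    "inward uniformity f (closure (V d \<epsilon> `` (f `` A)))"
    "closure (f `` A) \<subseteq> closure (V d \<epsilon> `` (f `` A))"
proof -
  have V: "V d \<epsilon> `` (f `` A) \<subseteq> closure (V d \<epsilon> `` (f `` A))"
    by (rule closure_subset)
  have le: "V d \<epsilon> `` (f `` B) \<subseteq> V d \<epsilon> `` (f `` A)" if "B \<subseteq> A" for B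
    using that by blast
  show "inward uniformity f (interior A)"
    using le[OF interior_subset] V sub by (intro inwardI[OF d]) blast
  have "closure (V d \<epsilon> `` (f `` A)) \<subseteq> A"
    using sub interior_subset by blast
  from le[OF this] V show "inward uniformity f (closure (V d \<epsilon> `` (f `` A)))"
    by (intro inwardI[OF d]) blast
  show "closure (f `` A) \<subseteq> closure (V d \<epsilon> `` (f `` A))"
    by (intro closure_mono subset_V_Image[OF d])
qed

text \<open>A chain whose first point lies in \<open>A\<close> stays in \<open>A\<close>, since its jumps are shorter than \<open>\<epsilon>\<close>.\<close>

lemma chain_d_endpoint:
  assumes "(x, y) \<in> chain_d d f" "0 < \<epsilon>"
    and start: "\<And>a. d x a < \<epsilon> \<Longrightarrow> a \<in> A"
    and step: "\<And>b a. b \<in> f `` A \<Longrightarrow> d b a < \<epsilon> \<Longrightarrow> a \<in> A"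
  shows "\<exists>b\<in>f `` A. d b y < \<epsilon>"
proof -
  obtain n a b where n: "1 \<le> n" and f: "\<And>i. i \<in> {1..n} \<Longrightarrow> (a i, b i) \<in> f"
    and a1: "d x (a 1) < \<epsilon>" and jump: "\<And>i. i \<in> {1..<n} \<Longrightarrow> d (b i) (a (Suc i)) < \<epsilon>"
    and bn: "d (b n) y < \<epsilon>"
    using assms(1,2) unfolding chain_d_def by blast
  have "a i \<in> A" if "1 \<le> i" "i \<le> n" for i
    using that
  proof (induction i rule: dec_induct)
    case base
    show ?case using start a1 by blast
  next
    case (step i)
    then have "b i \<in> f `` A"
      using f[of i] by auto
    moreover have "d (b i) (a (Suc i)) < \<epsilon>"
      using step.hyps step.prems jump[of i] by simp
    ultimately show ?case by (rule assms(4))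
  qed
  then have "a n \<in> A" using n by blast
  with f[of n] n bn show ?thesis by auto
qed

text \<open>Smallness for \<open>d\<close> alone does not force the first point of a chain into
  \<open>A\<close>. Openness of \<open>A\<close> supplies a second pseudo-metric \<open>d'\<close>
  that does, and the chain is taken for the sum of the two.\<close>

lemma V_chain_U_subset:
  fixes f :: "('a::uniform_space \<times> 'a) set"
  assumes "open A" and d: "d \<in> gage uniformity" "0 < \<epsilon>" and sub: "V d \<epsilon> `` (f `` A) \<subseteq> A"
  shows "V d \<epsilon> `` (chain_U uniformity f `` A) \<subseteq> A"
proof
  fix y
  assume "y \<in> V d \<epsilon> `` (chain_U uniformity f `` A)"
  then obtain x z where x: "x \<in> A" and xz: "(x, z) \<in> chain_U uniformity f" and zy: "d z y < \<epsilon>"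
    by (auto simp: V_def)
  obtain d' where d': "d' \<in> gage uniformity" "V d' 1 `` {x} \<subseteq> A"
    using open_gage_neighbourhood[OF \<open>open A\<close> x] .
  have nonneg: "0 \<le> d u v" "0 \<le> d' u v" and tri: "d u w \<le> d u v + d v w" for u v w
    using gage_bounded_pseudometric[OF d(1)] gage_bounded_pseudometric[OF d'(1)]
    unfolding bounded_pseudometric_def by blast+
  \<comment> \<open>The bound 1 puts the first point into \<open>A\<close> by way of
    \<open>d'\<close>. The other bound is at most \<open>\<epsilon>\<close>, which keeps the later
    jumps in \<open>A\<close>, and leaves room for the distance from \<open>z\<close> to
    \<open>y\<close> in the final triangle inequality.\<close>
  define \<delta> where "\<delta> = min 1 (\<epsilon> - d z y)"
  have \<delta>: "0 < \<delta>" "\<delta> \<le> 1" "\<delta> \<le> \<epsilon>" "\<delta> \<le> \<epsilon> - d z y"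
    using zy nonneg(1)[of z y] by (auto simp: \<delta>_def)
  have "(x, z) \<in> chain_d (\<lambda>u v. d u v + d' u v) f"
    using xz gage_add[OF d(1) d'(1)] unfolding chain_U_def by blast
  then have "\<exists>b\<in>f `` A. d b z + d' b z < \<delta>"
  proof (rule chain_d_endpoint[OF _ \<delta>(1)])
    show "a \<in> A" if "d x a + d' x a < \<delta>" for a
    proof -
      have "d' x a < 1"
        using that \<delta> nonneg(1)[of x a] by linarith
      then show ?thesis using d'(2) by (auto simp: V_def)
    qed
    show "a \<in> A" if "b \<in> f `` A" "d b a + d' b a < \<delta>" for b a
    proof -
      have "d b a < \<epsilon>"
        using that \<delta> nonneg(2)[of b a] by linarith
      then show ?thesis using sub that(1) by (auto simp: V_def)
    qed
  qed
  then obtain b where b: "b \<in> f `` A" "d b z + d' b z < \<delta>"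
    by blast
  have "d b y < \<epsilon>"
    using b(2) \<delta>(4) nonneg(2)[of b z] tri[of b y z] by linarith
  with b(1) sub show "y \<in> A" by (auto simp: V_def)
qed

text \<open>Interpolation replaces the entourage of the definition by a pair \<open>d\<close>,
  \<open>\<epsilon>\<close>, and this same pair then serves for the chain relation.\<close>

lemma inward_chain_U:
  fixes f :: "('a::uniform_space \<times> 'a) set"
  assumes "open A" "inward uniformity f A"
  shows "inward uniformity (chain_U uniformity f) A"
proof -
  obtain d \<epsilon> where d: "d \<in> gage uniformity" "0 < \<epsilon>"
    and sub: "closure (V d \<epsilon> `` (f `` A)) \<subseteq> interior A"
    using inward_interpolation[OF assms(2)] by blast
  have "V d \<epsilon> `` (f `` A) \<subseteq> A"
    using order_trans[OF closure_subset order_trans[OF sub interior_subset]] .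
  then show ?thesis
    by (intro inwardI[OF d] V_chain_U_subset[OF assms(1) d])
qed

text \<open>With \<open>L\<close> equal to 1 on \<open>f(A)\<close> and 0 off \<open>A\<close>, the
  set \<open>B\<close> where \<open>L\<close> is at most 1/2 misses \<open>f(A)\<close>. Hence its
  preimage under \<open>f\<close> misses \<open>A\<close>, so \<open>L\<close> vanishes there and
  stays below 1/2 within distance 1/2. The open sets \<open>L > 0\<close> and \<open>L < 1/2\<close>
  give the covering by interiors.\<close>

lemma inward_converse:
  fixes f :: "('a::uniform_space \<times> 'a) set"
  assumes "inward uniformity f A"
  shows "\<exists>B. closed B \<and> inward uniformity (f\<inverse>) B \<and> interior A \<union> interior B = UNIV \<and>
    B \<inter> f `` A = {} \<and> A \<inter> f\<inverse> `` B = {}"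
proof -
  obtain L where "separates L (f `` A) A"
    using inward_urysohn[OF assms] .
  note L = separatesD[OF this]
  have cont: "continuous_on UNIV L"
    using L(1) by (rule uniform_continuity_imp_continuous)
  define B where "B = {x. L x \<le> 1/2}"
  have BfA: "B \<inter> f `` A = {}"
    using L(3) by (force simp: B_def)
  then have AfB: "A \<inter> f\<inverse> `` B = {}"
    by blast
  have "V (d_fun L) (1/2) `` (f\<inverse> `` B) \<subseteq> B"
  proof
    fix y
    assume "y \<in> V (d_fun L) (1/2) `` (f\<inverse> `` B)"
    then obtain x where "x \<in> f\<inverse> `` B" "\<bar>L x - L y\<bar> < 1/2"
      by (auto simp: V_def d_fun_def)
    moreover from this AfB have "L x = 0"
      by (intro L(4)) blast
    ultimately show "y \<in> B"
      by (simp add: B_def)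
  qed
  then have "inward uniformity (f\<inverse>) B"
    by (intro inwardI[OF d_fun_gage[OF L(1,2)]]) auto
  moreover have "closed B"
    unfolding B_def using cont by (intro closed_Collect_le) auto
  moreover have "{x. 0 < L x} \<subseteq> interior A"
    using L(4) by (intro interior_maximal open_greater[OF L(1)]) force
  moreover have "{x. L x < 1/2} \<subseteq> interior B"
    using cont by (intro interior_maximal open_Collect_less) (auto simp: B_def)
  then have "{x. \<not> 0 < L x} \<subseteq> interior B"
    by force
  ultimately show ?thesis
    using BfA AfB by blast
qed

text \<open>The separating function itself works: a point where it is positive lies in
  \<open>A\<close>, so its images lie in \<open>f(A)\<close>, where the value is 1.\<close>

lemma inward_imp_elementary_lyapunov:
  fixes f :: "('a::uniform_space \<times> 'a) set"
  assumes "inward uniformity f A"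
  shows "\<exists>L. elementary_lyapunov uniformity f L \<and> L -` {0} \<union> A = UNIV \<and> f `` A \<subseteq> L -` {1}"
proof -
  obtain L where "separates L (f `` A) A"
    using inward_urysohn[OF assms] .
  note L = separatesD[OF this]
  have "L y = 1" if "(x, y) \<in> f" "0 < L x" for x y
  proof -
    have "x \<in> A" using L(4)[of x] that(2) by force
    with that(1) show ?thesis by (intro L(3)) blast
  qed
  then have "elementary_lyapunov uniformity f L"
    unfolding elementary_lyapunov_def using L(1,2) by blast
  with L(3,4) show ?thesis by blast
qed

section \<open>Elementary Lyapunov functions\<close>

lemma elementary_lyapunovD:
  assumes "elementary_lyapunov \<U> f L"
  shows "filterlim (\<lambda>(x, y). (L x, L y)) uniformity \<U>" "\<And>x. L x \<in> {0..1}"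
    "\<And>x y. (x, y) \<in> f \<Longrightarrow> 0 < L x \<Longrightarrow> L y = 1"
  using assms unfolding elementary_lyapunov_def by auto

lemma elementary_lyapunov_gage: "elementary_lyapunov \<U> f L \<Longrightarrow> d_fun L \<in> gage \<U>"
  by (intro d_fun_gage elementary_lyapunovD)

text \<open>A pair of \<open>f\<close> is a chain with a single link, whose two outer jumps have
  length 0.\<close>

lemma subset_chain_d:
  assumes "bounded_pseudometric d"
  shows "f \<subseteq> chain_d d f"
proof safe
  fix x y
  assume "(x, y) \<in> f"
  moreover have "d x x = 0" "d y y = 0"
    using assms unfolding bounded_pseudometric_def by auto
  ultimately show "(x, y) \<in> chain_d d f"
    unfolding chain_d_def
    by (intro CollectI case_prodI allI impI exI[of _ "1::nat"] exI[of _ "\<lambda>_. x"]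
        exI[of _ "\<lambda>_. y"] conjI) auto
qed

lemma subset_chain_U: "f \<subseteq> chain_U \<U> f"
  unfolding chain_U_def using subset_chain_d gage_bounded_pseudometric by blast

lemma chain_U_subset: "d \<in> gage \<U> \<Longrightarrow> chain_U \<U> f \<subseteq> chain_d d f"
  unfolding chain_U_def by blast

text \<open>Short jumps cannot leave the set where \<open>L\<close> is positive, neither from
  \<open>x\<close> nor from an image point, where \<open>L\<close> is 1. So the last link ends at
  value 1, arbitrarily close to \<open>L y\<close>.\<close>

lemma chain_d_fun_eq_1:
  assumes L: "elementary_lyapunov \<U> f L" and xy: "(x, y) \<in> chain_d (d_fun L) f" and "0 < L x"
  shows "L y = 1"
proof (rule ccontr)
  assume "L y \<noteq> 1"
  \<comment> \<open>\<open>L x\<close> guards the first jump and \<open>\<bar>1 - L y\<bar>\<close>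
    gives the contradiction at the last. The intermediate jumps start at value 1 and need only
    \<open>\<delta> \<le> 1\<close>, which follows from \<open>L x \<le> 1\<close>.\<close>
  define \<delta> where "\<delta> = min (L x) \<bar>1 - L y\<bar>"
  have \<delta>: "0 < \<delta>" "\<delta> \<le> L x" "\<delta> \<le> \<bar>1 - L y\<bar>" "\<delta> \<le> 1"
    using \<open>L y \<noteq> 1\<close> \<open>0 < L x\<close> elementary_lyapunovD(2)[OF L, of x] by (auto simp: \<delta>_def)
  have f: "L b = 1" if "b \<in> f `` {x. 0 < L x}" for b
    using that elementary_lyapunovD(3)[OF L] by blast
  have "\<exists>b\<in>f `` {x. 0 < L x}. d_fun L b y < \<delta>"
    using xy \<delta>(1)
  proof (rule chain_d_endpoint)
    show "a \<in> {x. 0 < L x}" if "d_fun L x a < \<delta>" for a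
      using that \<delta> by (auto simp: d_fun_def)
    show "a \<in> {x. 0 < L x}" if "b \<in> f `` {x. 0 < L x}" "d_fun L b a < \<delta>" for b a
      using that(2) f[OF that(1)] \<delta> by (auto simp: d_fun_def)
  qed
  then show False
    using f \<delta>(3) by (auto simp: d_fun_def)
qed

text \<open>\<open>L\<close> is 1-Lipschitz for its own pseudo-metric.\<close>

lemma filterlim_uniformity_of_d_fun:
  "filterlim (\<lambda>(x, y). (L x, L y)) uniformity (uniformity_of (d_fun L))"
proof (rule uniform_continuityI)
  fix e :: real
  assume "0 < e"
  then have "uniformity_of (d_fun L) \<le> principal (V (d_fun L) e)"
    unfolding uniformity_of_def by (intro INF_lower) auto
  then have "eventually (\<lambda>p. p \<in> V (d_fun L) e) (uniformity_of (d_fun L))"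
    by (simp add: le_principal)
  then show "eventually (\<lambda>(x, y). \<bar>L x - L y\<bar> < e) (uniformity_of (d_fun L))"
    by eventually_elim (auto simp: V_def d_fun_def)
qed

lemma elementary_lyapunov_chain_d:
  assumes "elementary_lyapunov \<U> f L"
  shows "elementary_lyapunov (uniformity_of (d_fun L)) (chain_d (d_fun L) f) L"
  using filterlim_uniformity_of_d_fun[of L] elementary_lyapunovD(2)[OF assms]
    chain_d_fun_eq_1[OF assms]
  unfolding elementary_lyapunov_def by blast

text \<open>Since \<open>d_fun L\<close> belongs to the gage, \<open>chain_U\<close> is contained in
  the chain relation of \<open>d_fun L\<close>.\<close>

lemma elementary_lyapunov_chain_U:
  assumes "elementary_lyapunov \<U> f L"
  shows "elementary_lyapunov \<U> (chain_U \<U> f) L"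
  using elementary_lyapunovD(1,2)[OF assms] chain_d_fun_eq_1[OF assms]
    chain_U_subset[OF elementary_lyapunov_gage[OF assms], of f]
  unfolding elementary_lyapunov_def by blast

text \<open>The Lyapunov condition, read as \<open>L x \<le> 0\<close> or \<open>L y = 1\<close>,
  defines a closed subset of the product because \<open>L\<close> is continuous.\<close>

lemma elementary_lyapunov_closure:
  fixes f :: "('a::uniform_space \<times> 'a) set"
  assumes "elementary_lyapunov uniformity f L"
  shows "elementary_lyapunov uniformity (closure f) L"
proof -
  note L = elementary_lyapunovD[OF assms]
  have cont: "continuous_on UNIV L"
    using L(1) by (rule uniform_continuity_imp_continuous)
  have "continuous_on UNIV (\<lambda>p::'a \<times> 'a. L (fst p))" "continuous_on UNIV (\<lambda>p::'a \<times> 'a. L (snd p))"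
    by (intro continuous_on_compose2[OF cont] continuous_intros; simp)+
  then have "closed {p::'a \<times> 'a. L (fst p) \<le> 0 \<or> L (snd p) = 1}"
    by (intro closed_Collect_disj closed_Collect_le closed_Collect_eq) auto
  moreover have "f \<subseteq> {p. L (fst p) \<le> 0 \<or> L (snd p) = 1}"
    using L(3) by force
  ultimately have "closure f \<subseteq> {p. L (fst p) \<le> 0 \<or> L (snd p) = 1}"
    by (intro closure_minimal)
  then have "\<forall>x y. (x, y) \<in> closure f \<and> 0 < L x \<longrightarrow> L y = 1"
    by force
  with L(1,2) show ?thesis
    unfolding elementary_lyapunov_def by blast
qed

text \<open>From \<open>\<epsilon> \<le> 1\<close> it follows that \<open>L\<close> is positive on
  \<open>A\<close>, so chains from \<open>A\<close> end at value 1; moving by less than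
  \<open>\<epsilon>\<close> from there keeps the value above \<open>1 - \<epsilon>\<close>.\<close>

lemma elementary_lyapunov_superlevel:
  fixes f :: "('a::uniform_space \<times> 'a) set"
  assumes L: "elementary_lyapunov uniformity f L" and "\<epsilon> \<le> 1" and A: "A = {x. 1 - \<epsilon> < L x}"
  shows "open A" "f `` A \<subseteq> chain_U uniformity f `` A"
    "chain_U uniformity f `` A \<subseteq> chain_d (d_fun L) f `` A"
    "chain_d (d_fun L) f `` A \<subseteq> L -` {1}"
    "V (d_fun L) \<epsilon> `` (chain_d (d_fun L) f `` A) \<subseteq> A"
proof -
  show "open A"
    unfolding A using elementary_lyapunovD(1)[OF L] by (rule open_greater)
  show "f `` A \<subseteq> chain_U uniformity f `` A"
    by (intro Image_mono subset_chain_U subset_refl)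
  show "chain_U uniformity f `` A \<subseteq> chain_d (d_fun L) f `` A"
    by (intro Image_mono chain_U_subset elementary_lyapunov_gage[OF L] subset_refl)
  show eq_1: "chain_d (d_fun L) f `` A \<subseteq> L -` {1}"
    using chain_d_fun_eq_1[OF L] \<open>\<epsilon> \<le> 1\<close> by (fastforce simp: A)
  have "V (d_fun L) \<epsilon> `` (L -` {1}) \<subseteq> A"
    by (auto simp: V_def d_fun_def A)
  with eq_1 show "V (d_fun L) \<epsilon> `` (chain_d (d_fun L) f `` A) \<subseteq> A"
    by blast
qed

text \<open>This is the contrapositive of the condition on \<open>L\<close>: if
  \<open>L y < 1\<close> for a pair of \<open>f\<close>, then \<open>L x\<close> cannot be positive
  and is 0.\<close>

lemma elementary_lyapunov_converse:
  assumes "elementary_lyapunov \<U> f L"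
  shows "elementary_lyapunov \<U> (f\<inverse>) (\<lambda>x. 1 - L x)"
proof -
  note L = elementary_lyapunovD[OF assms]
  have "filterlim (\<lambda>(x, y). (1 - L x, 1 - L y)) uniformity \<U>"
  proof (rule uniform_continuityI)
    fix e :: real
    assume "0 < e"
    from uniform_continuityD[OF L(1) this]
    show "eventually (\<lambda>(x, y). \<bar>(1 - L x) - (1 - L y)\<bar> < e) \<U>"
      by eventually_elim auto
  qed
  moreover have "1 - L x = 1" if "(x, y) \<in> f" "0 < 1 - L y" for x y
    using L(2)[of x] L(3)[OF that(1)] that(2) by force
  ultimately show ?thesis
    unfolding elementary_lyapunov_def using L(2) by auto
qed

section \<open>Assembly of the six claims\<close>

theorem theorem5p16:
  fixes f :: "('a::uniform_space \<times> 'a) set"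
  shows
   "(\<forall>A. inward uniformity f A \<longrightarrow>
       (\<exists>d\<in>gage uniformity. \<exists>\<epsilon>>0. closure (V d \<epsilon> `` (f `` A)) \<subseteq> interior A) \<and>
       (\<forall>d\<in>gage uniformity. \<forall>\<epsilon>>0. closure (V d \<epsilon> `` (f `` A)) \<subseteq> interior A \<longrightarrow>
          (\<forall>A1 A2. A1 = interior A \<and> A2 = closure (V d \<epsilon> `` (f `` A)) \<longrightarrow>
             inward uniformity f A1 \<and> inward uniformity f A2 \<and> open A1 \<and> closed A2 \<and>
             closure (f `` A) \<subseteq> A2 \<and> A2 \<subseteq> A1 \<and> A1 \<subseteq> A)))
    \<and>
    (\<forall>A. open A \<and> inward uniformity f A \<longrightarrow>
       (\<forall>d\<in>gage uniformity. \<forall>\<epsilon>>0. V d \<epsilon> `` (f `` A) \<subseteq> A \<longrightarrow>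
          V d \<epsilon> `` (chain_U uniformity f `` A) \<subseteq> A \<and>
          plus_invariant (chain_U uniformity f O V d \<epsilon>) A) \<and>
       inward uniformity (chain_U uniformity f) A)
    \<and>
    (\<forall>A. inward uniformity f A \<longrightarrow>
       (\<exists>B. closed B \<and> inward uniformity (f\<inverse>) B \<and>
            interior A \<union> interior B = UNIV \<and>
            B \<inter> f `` A = {} \<and> A \<inter> f\<inverse> `` B = {}))
    \<and>
    (\<forall>A. inward uniformity f A \<longrightarrow>
       (\<exists>L. elementary_lyapunov uniformity f L \<and>
            L -` {0} \<union> A = UNIV \<and> f `` A \<subseteq> L -` {1}))
    \<and>
    (\<forall>L. elementary_lyapunov uniformity f L \<longrightarrow>
       (\<forall>\<epsilon> A. 0 < \<epsilon> \<and> \<epsilon> \<le> 1 \<and> A = {x. L x > 1 - \<epsilon>} \<longrightarrow>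
          open A \<and>
          f `` A \<subseteq> chain_U uniformity f `` A \<and>
          chain_U uniformity f `` A \<subseteq> chain_d (d_fun L) f `` A \<and>
          chain_d (d_fun L) f `` A \<subseteq> L -` {1} \<and>
          V (d_fun L) \<epsilon> `` (f `` A) \<subseteq> V (d_fun L) \<epsilon> `` (chain_U uniformity f `` A) \<and>
          V (d_fun L) \<epsilon> `` (chain_U uniformity f `` A)
            \<subseteq> V (d_fun L) \<epsilon> `` (chain_d (d_fun L) f `` A) \<and>
          V (d_fun L) \<epsilon> `` (chain_d (d_fun L) f `` A) \<subseteq> A) \<and>
       elementary_lyapunov (uniformity_of (d_fun L)) (chain_d (d_fun L) f) L \<and>
       elementary_lyapunov uniformity (chain_U uniformity f) L \<and>
       elementary_lyapunov uniformity (closure f) L)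
    \<and>
    (\<forall>L. elementary_lyapunov uniformity f L \<longrightarrow>
       elementary_lyapunov uniformity (f\<inverse>) (\<lambda>x. 1 - L x))"
proof (intro conjI; intro allI impI)
  fix A
  assume A: "inward uniformity f A"
  show "(\<exists>d\<in>gage uniformity. \<exists>\<epsilon>>0. closure (V d \<epsilon> `` (f `` A)) \<subseteq> interior A) \<and>
       (\<forall>d\<in>gage uniformity. \<forall>\<epsilon>>0. closure (V d \<epsilon> `` (f `` A)) \<subseteq> interior A \<longrightarrow>
          (\<forall>A1 A2. A1 = interior A \<and> A2 = closure (V d \<epsilon> `` (f `` A)) \<longrightarrow>
             inward uniformity f A1 \<and> inward uniformity f A2 \<and> open A1 \<and> closed A2 \<and>
             closure (f `` A) \<subseteq> A2 \<and> A2 \<subseteq> A1 \<and> A1 \<subseteq> A))"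
    using inward_interpolation[OF A]
    by (auto simp: inward_interior_closure interior_subset
        dest: subsetD[OF interior_subset] inward_interior_closure(3)[THEN subsetD, rotated 3])
next
  fix A
  assume A: "open A \<and> inward uniformity f A"
  show "(\<forall>d\<in>gage uniformity. \<forall>\<epsilon>>0. V d \<epsilon> `` (f `` A) \<subseteq> A \<longrightarrow>
          V d \<epsilon> `` (chain_U uniformity f `` A) \<subseteq> A \<and>
          plus_invariant (chain_U uniformity f O V d \<epsilon>) A) \<and>
       inward uniformity (chain_U uniformity f) A"
    \<comment> \<open>The image under the composite is the image of an image, so the invariance
      claim is the inclusion for \<open>V d \<epsilon>\<close> again.\<close>
    using A V_chain_U_subset[of A _ _ f] inward_chain_U[of A f]
    by (simp add: plus_invariant_def relcomp_Image)
next
  fix L :: "'a \<Rightarrow> real"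
  assume L: "elementary_lyapunov uniformity f L"
  show "(\<forall>\<epsilon> A. 0 < \<epsilon> \<and> \<epsilon> \<le> 1 \<and> A = {x. L x > 1 - \<epsilon>} \<longrightarrow>
          open A \<and>
          f `` A \<subseteq> chain_U uniformity f `` A \<and>
          chain_U uniformity f `` A \<subseteq> chain_d (d_fun L) f `` A \<and>
          chain_d (d_fun L) f `` A \<subseteq> L -` {1} \<and>
          V (d_fun L) \<epsilon> `` (f `` A) \<subseteq> V (d_fun L) \<epsilon> `` (chain_U uniformity f `` A) \<and>
          V (d_fun L) \<epsilon> `` (chain_U uniformity f `` A)
            \<subseteq> V (d_fun L) \<epsilon> `` (chain_d (d_fun L) f `` A) \<and>
          V (d_fun L) \<epsilon> `` (chain_d (d_fun L) f `` A) \<subseteq> A) \<and>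
       elementary_lyapunov (uniformity_of (d_fun L)) (chain_d (d_fun L) f) L \<and>
       elementary_lyapunov uniformity (chain_U uniformity f) L \<and>
       elementary_lyapunov uniformity (closure f) L"
  proof (intro conjI; (intro allI impI; elim conjE)?)
    fix \<epsilon> A
    assume A: "\<epsilon> \<le> 1" "A = {x. L x > 1 - \<epsilon>}"
    note super = elementary_lyapunov_superlevel[OF L A]
    show "open A \<and>
          f `` A \<subseteq> chain_U uniformity f `` A \<and>
          chain_U uniformity f `` A \<subseteq> chain_d (d_fun L) f `` A \<and>
          chain_d (d_fun L) f `` A \<subseteq> L -` {1} \<and>
          V (d_fun L) \<epsilon> `` (f `` A) \<subseteq> V (d_fun L) \<epsilon> `` (chain_U uniformity f `` A) \<and>
          V (d_fun L) \<epsilon> `` (chain_U uniformity f `` A)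
            \<subseteq> V (d_fun L) \<epsilon> `` (chain_d (d_fun L) f `` A) \<and>
          V (d_fun L) \<epsilon> `` (chain_d (d_fun L) f `` A) \<subseteq> A"
      by (intro conjI super Image_mono[OF subset_refl])
  qed (fact elementary_lyapunov_chain_d[OF L] elementary_lyapunov_chain_U[OF L]
      elementary_lyapunov_closure[OF L])+
qed (intro inward_converse inward_imp_elementary_lyapunov elementary_lyapunov_converse; assumption)+

end
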